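(* Let $N\ge 1$. Every continuous polynomial map $f:\mathbb{R}_{\ge 0}^N\to\mathbb{R}$ of degree $d$ (where $\mathbb{R}_{\ge0}^N$ is regarded as a commutative semigroup under addition and $\mathbb{R}$ as the additive group) is given by a polynomial in $N$ variables, with real coefficients, of degree $d$ in the usual sense.
   Context: The degree of the zero polynomial is $-\infty$. Let $S$ be a nonempty commutative semigroup (written additively) and $G$ a group with identity $1_G$. A map $f:S\to G$ is a polynomial map of degree $-\infty$ if $f(s)=1_G$ for all $s$, and of degree $0$ if it is constant with value different from $1_G$. Thus degree $\le 0$ means constant. Inductively, for $d\in\{0,1,2,\dots\}$, $f$ is a polynomial map of degree $\le d+1$ if for every $s\in S$ both maps $L_s(f):t\mapsto f(s+t)f(t)^{-1}$ and $R_s(f):t\mapsto f(t)^{-1}f(s+t)$ from $S$ to $G$ are polynomial maps of degree $\le d$ (for $G=\mathbb{R}$, both are $t\mapsto f(s+t)-f(t)$). The degree of a polynomial map is the least such $d\in\{-\infty,0,1,2,\dots\}$. A map is a polynomial map if it is a polynomial map of degree $\le d$ for some $d$. *)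

theory Defs
  imports "HOL-Analysis.Analysis" "HOL-Library.Poly_Mapping" "HOL-Library.Option_ord"
begin

text \<open>Degrees range over \<open>nat option\<close>, where \<open>None\<close> stands for minus infinity; the order of
  \<^theory>\<open>HOL-Library.Option_ord\<close> has \<open>None\<close> as least element and is a well-order.\<close>

text \<open>The semigroup is a subset \<open>S\<close> of a commutative semigroup, nonempty and closed under addition
  in every intended use; values of a map outside \<open>S\<close> are irrelevant.  The target is a group,
  written additively but not assumed commutative (class \<^class>\<open>group_add\<close>).\<close>

fun polynomial_map_le ::
  "'a::ab_semigroup_add set \<Rightarrow> nat option \<Rightarrow> ('a \<Rightarrow> 'b::group_add) \<Rightarrow> bool" where
  "polynomial_map_le S None f \<longleftrightarrow> (\<forall>s\<in>S. f s = 0)"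
| "polynomial_map_le S (Some 0) f \<longleftrightarrow> (\<exists>c. \<forall>s\<in>S. f s = c)"
| "polynomial_map_le S (Some (Suc d)) f \<longleftrightarrow>
     (\<forall>s\<in>S. polynomial_map_le S (Some d) (\<lambda>t. f (s + t) + - f t) \<and>
             polynomial_map_le S (Some d) (\<lambda>t. - f t + f (s + t)))"

definition polynomial_map :: "'a::ab_semigroup_add set \<Rightarrow> ('a \<Rightarrow> 'b::group_add) \<Rightarrow> bool" where
  "polynomial_map S f \<longleftrightarrow> (\<exists>d. polynomial_map_le S d f)"

text \<open>Meaningful only if \<open>polynomial_map S f\<close>.\<close>

definition polynomial_map_degree ::
  "'a::ab_semigroup_add set \<Rightarrow> ('a \<Rightarrow> 'b::group_add) \<Rightarrow> nat option" where
  "polynomial_map_degree S f = (LEAST d. polynomial_map_le S d f)"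

lemma polynomial_map_degree_None_iff:
  "polynomial_map S f \<and> polynomial_map_degree S f = None \<longleftrightarrow> (\<forall>s\<in>S. f s = 0)"
proof
  assume "polynomial_map S f \<and> polynomial_map_degree S f = None"
  then show "\<forall>s\<in>S. f s = 0"
    unfolding polynomial_map_def polynomial_map_degree_def
    by (metis LeastI polynomial_map_le.simps(1))
next
  assume *: "\<forall>s\<in>S. f s = 0"
  then have "(LEAST d. polynomial_map_le S d f) = None"
    by (intro Least_equality) auto
  then show "polynomial_map S f \<and> polynomial_map_degree S f = None"
    using * unfolding polynomial_map_def polynomial_map_degree_def
    by (metis polynomial_map_le.simps(1))
qed

lemma polynomial_map_degree_0_iff:
  assumes "S \<noteq> {}"
  shows "polynomial_map S f \<and> polynomial_map_degree S f = Some 0 \<longleftrightarrow>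
    (\<exists>c. c \<noteq> 0 \<and> (\<forall>s\<in>S. f s = c))"
proof
  assume *: "polynomial_map S f \<and> polynomial_map_degree S f = Some 0"
  then have "polynomial_map_le S (Some 0) f"
    unfolding polynomial_map_def polynomial_map_degree_def by (metis LeastI)
  then obtain c where c: "\<forall>s\<in>S. f s = c" by auto
  moreover have "c \<noteq> 0"
    using * c polynomial_map_degree_None_iff[of S f] by auto
  ultimately show "\<exists>c. c \<noteq> 0 \<and> (\<forall>s\<in>S. f s = c)" by blast
next
  assume "\<exists>c. c \<noteq> 0 \<and> (\<forall>s\<in>S. f s = c)"
  then obtain c where c: "c \<noteq> 0" "\<forall>s\<in>S. f s = c" by blast
  have le: "polynomial_map_le S (Some 0) f" using c by auto
  have "(LEAST d. polynomial_map_le S d f) = Some 0"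
  proof (rule Least_equality)
    show "polynomial_map_le S (Some 0) f" by (fact le)
  next
    fix d assume "polynomial_map_le S d f"
    then show "Some 0 \<le> d" using c assms by (cases d) auto
  qed
  with le show "polynomial_map S f \<and> polynomial_map_degree S f = Some 0"
    unfolding polynomial_map_def polynomial_map_degree_def by blast
qed

definition nonneg_orthant :: "(real ^ 'n) set" where
  "nonneg_orthant = {x. \<forall>i. 0 \<le> x $ i}"

lemma zero_in_nonneg_orthant: "0 \<in> nonneg_orthant"
  by (simp add: nonneg_orthant_def)

lemma add_in_nonneg_orthant:
  "x \<in> nonneg_orthant \<Longrightarrow> y \<in> nonneg_orthant \<Longrightarrow> x + y \<in> nonneg_orthant"
  by (simp add: nonneg_orthant_def)

text \<open>Multivariate polynomials as finitely supported families of coefficients indexed by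
  exponent vectors; the ring structure is that of \<^theory>\<open>HOL-Library.Poly_Mapping\<close>.\<close>

type_synonym 'n mpolynomial = "('n \<Rightarrow>\<^sub>0 nat) \<Rightarrow>\<^sub>0 real"

definition mpoly_eval :: "'n::finite mpolynomial \<Rightarrow> real ^ 'n \<Rightarrow> real" where
  "mpoly_eval p x =
     (\<Sum>m\<in>Poly_Mapping.keys p.
        Poly_Mapping.lookup p m * (\<Prod>i\<in>UNIV. (x $ i) ^ Poly_Mapping.lookup m i))"

definition mpoly_degree :: "'n::finite mpolynomial \<Rightarrow> nat option" where
  "mpoly_degree p =
     (if p = 0 then None
      else Some (Max ((\<lambda>m. \<Sum>i\<in>UNIV. Poly_Mapping.lookup m i) ` Poly_Mapping.keys p)))"

end

theory Submission
  imports Defs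
begin

text \<open>Let \<open>f\<close> be a continuous polynomial map of degree at most \<open>d\<close> on the orthant.  On a lattice in a
  half-line, finite differences of order \<open>d + 1\<close> vanish, so Newton's forward difference formula
  exhibits \<open>f\<close> as a univariate polynomial there.  The lattices of mesh \<open>1/q\<close> for
  \<open>q = 1, 2, \<dots>\<close> all contain the natural numbers, so their polynomials coincide, and by density of the
  rationals and continuity the same formula holds on the whole half-line
  (\<open>newton_interpolation_real\<close>).

  Applied along the coordinate \<open>i\<close> this reads
  \<open>f x = (\<Sum>k\<le>d. (x $ i gchoose k) * F k x)\<close>, where \<open>F k x\<close> is the \<open>k\<close>-th difference of \<open>f\<close> in
  direction \<open>axis i 1\<close>, evaluated at \<open>x\<close> with its \<open>i\<close>-th coordinate set to zero.  The map \<open>F k\<close> is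
  again continuous, does not depend on \<open>x $ i\<close>, and has degree at most \<open>d - k\<close>: the loss in degree
  compensates exactly for the degree \<open>k\<close> of the factor \<open>x $ i gchoose k\<close>.  Removing one coordinate
  after another therefore yields a polynomial whose \<^emph>\<open>total\<close> degree is at most \<open>d\<close>
  (\<open>mpoly_fun_if_depends_on\<close>).

  Conversely, by the product rule for differences, a polynomial of total degree \<open>e\<close> is a polynomial
  map of degree at most \<open>e\<close> (\<open>polynomial_map_le_mpoly_eval\<close>).  Since the degree of a polynomial map
  is the least possible bound, both inequalities together give equality of the degrees, without any
  uniqueness statement for multivariate polynomials.\<close>

section \<open>Calculus of polynomial maps\<close>

definition fwd_diff :: "'a::plus \<Rightarrow> ('a \<Rightarrow> 'b::minus) \<Rightarrow> 'a \<Rightarrow> 'b" where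
  "fwd_diff s f t = f (s + t) - f t"

lemma fwd_diff_funpow_Suc:
  "(fwd_diff s ^^ Suc k) f t = (fwd_diff s ^^ k) f (s + t) - (fwd_diff s ^^ k) f t"
  by (simp add: fwd_diff_def)

text \<open>In a commutative target the left and the right difference agree.\<close>

lemma polynomial_map_le_Suc_iff:
  fixes f :: "'a::ab_semigroup_add \<Rightarrow> 'b::ab_group_add"
  shows "polynomial_map_le S (Some (Suc d)) f \<longleftrightarrow>
    (\<forall>s\<in>S. polynomial_map_le S (Some d) (fwd_diff s f))"
  by (simp add: fwd_diff_def[abs_def])

text \<open>A map \<open>\<psi>\<close> with \<open>\<psi> (s + t) = \<phi> s + \<psi> t\<close> carries differences with step \<open>s\<close> to differences with
  step \<open>\<phi> s\<close>, so composition with it preserves degree bounds.  This one fact covers translations,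
  coordinate projections, half-lines and lattices inside them.  Since \<open>g\<close> has to agree with
  \<open>f \<circ> \<psi>\<close> on \<open>S\<close> only, it also yields the congruence rule below.\<close>

lemma polynomial_map_le_affine_comp:
  fixes f :: "'a::ab_semigroup_add \<Rightarrow> 'b::group_add"
    and \<psi> :: "'c::ab_semigroup_add \<Rightarrow> 'a"
  assumes f: "polynomial_map_le T d f"
    and \<phi>: "\<And>s. s \<in> S \<Longrightarrow> \<phi> s \<in> T" and \<psi>: "\<And>t. t \<in> S \<Longrightarrow> \<psi> t \<in> T"
    and closed: "\<And>s t. s \<in> S \<Longrightarrow> t \<in> S \<Longrightarrow> s + t \<in> S"
    and affine: "\<And>s t. s \<in> S \<Longrightarrow> t \<in> S \<Longrightarrow> \<psi> (s + t) = \<phi> s + \<psi> t"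
    and g: "\<And>t. t \<in> S \<Longrightarrow> g t = f (\<psi> t)"
  shows "polynomial_map_le S d g"
proof (cases d)
  case None
  then show ?thesis using f \<psi> g by auto
next
  case (Some n)
  have "polynomial_map_le S (Some n) g"
    if "polynomial_map_le T (Some n) f" "\<And>t. t \<in> S \<Longrightarrow> g t = f (\<psi> t)" for f g
    using that
  proof (induction n arbitrary: f g)
    case 0
    then show ?case using \<psi> by auto
  next
    case (Suc n)
    show ?case
      unfolding polynomial_map_le.simps
    proof (intro ballI conjI)
      fix s assume s: "s \<in> S"
      have IH: "polynomial_map_le T (Some n) (\<lambda>t. f (\<phi> s + t) + - f t)"
        "polynomial_map_le T (Some n) (\<lambda>t. - f t + f (\<phi> s + t))"
        using Suc.prems(1) \<phi>[OF s] by simp_all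
      show "polynomial_map_le S (Some n) (\<lambda>t. g (s + t) + - g t)"
        by (rule Suc.IH[OF IH(1)]) (simp add: Suc.prems(2) affine closed s)
      show "polynomial_map_le S (Some n) (\<lambda>t. - g t + g (s + t))"
        by (rule Suc.IH[OF IH(2)]) (simp add: Suc.prems(2) affine closed s)
    qed
  qed
  with Some f g show ?thesis by blast
qed

lemma polynomial_map_le_cong:
  fixes f g :: "'a::ab_semigroup_add \<Rightarrow> 'b::group_add"
  assumes "polynomial_map_le S d f"
    and "\<And>s t. s \<in> S \<Longrightarrow> t \<in> S \<Longrightarrow> s + t \<in> S" and "\<And>t. t \<in> S \<Longrightarrow> g t = f t"
  shows "polynomial_map_le S d g"
  by (rule polynomial_map_le_affine_comp[OF assms(1), where \<phi> = "\<lambda>s. s" and \<psi> = "\<lambda>s. s"])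
    (use assms in auto)

lemma polynomial_map_le_shift:
  fixes f :: "'a::ab_semigroup_add \<Rightarrow> 'b::group_add"
  assumes "polynomial_map_le S d f"
    and "\<And>s t. s \<in> S \<Longrightarrow> t \<in> S \<Longrightarrow> s + t \<in> S" and "a \<in> S"
  shows "polynomial_map_le S d (\<lambda>t. f (a + t))"
  by (rule polynomial_map_le_affine_comp[OF assms(1), where \<phi> = "\<lambda>s. s" and \<psi> = "\<lambda>t. a + t"])
    (use assms in \<open>auto simp: ac_simps\<close>)

lemma polynomial_map_le_const:
  fixes c :: "'b::ab_group_add"
  shows "polynomial_map_le S (Some d) (\<lambda>_. c)"
proof (induction d arbitrary: c)
  case (Suc d)
  then show ?case by simp
qed auto

lemma polynomial_map_le_mono:
  fixes f :: "'a::ab_semigroup_add \<Rightarrow> 'b::ab_group_add"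
  assumes "polynomial_map_le S (Some d) f" "d \<le> e"
    and closed: "\<And>s t. s \<in> S \<Longrightarrow> t \<in> S \<Longrightarrow> s + t \<in> S"
  shows "polynomial_map_le S (Some e) f"
  using assms(1,2)
proof (induction d arbitrary: e f)
  case 0
  then obtain c where "\<forall>s\<in>S. f s = c" by auto
  then show ?case
    using polynomial_map_le_cong[OF polynomial_map_le_const[of S e c] closed] by auto
next
  case (Suc d)
  then obtain e' where "e = Suc e'" "d \<le> e'" by (cases e) auto
  then show ?case using Suc by (auto simp: polynomial_map_le_Suc_iff simp del: polynomial_map_le.simps)
qed

lemma polynomial_map_le_add:
  fixes f g :: "'a::ab_semigroup_add \<Rightarrow> 'b::ab_group_add"
  assumes "polynomial_map_le S (Some d) f" "polynomial_map_le S (Some d) g"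
  shows "polynomial_map_le S (Some d) (\<lambda>t. f t + g t)"
  using assms
proof (induction d arbitrary: f g)
  case 0
  then show ?case by auto
next
  case (Suc d)
  have "fwd_diff s (\<lambda>t. f t + g t) = (\<lambda>t. fwd_diff s f t + fwd_diff s g t)" for s
    by (auto simp: fwd_diff_def fun_eq_iff)
  then show ?case
    using Suc by (auto simp: polynomial_map_le_Suc_iff simp del: polynomial_map_le.simps)
qed

lemma polynomial_map_le_sum:
  fixes f :: "'i \<Rightarrow> 'a::ab_semigroup_add \<Rightarrow> 'b::ab_group_add"
  assumes "\<And>i. i \<in> I \<Longrightarrow> polynomial_map_le S (Some d) (f i)"
  shows "polynomial_map_le S (Some d) (\<lambda>t. \<Sum>i\<in>I. f i t)"
  using assms
proof (induction I rule: infinite_finite_induct)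
  case (insert i I)
  then show ?case using polynomial_map_le_add[of S d "f i" "\<lambda>t. \<Sum>i\<in>I. f i t"] by simp
qed (simp_all add: polynomial_map_le_const del: polynomial_map_le.simps)

lemma polynomial_map_le_const_mult:
  fixes f :: "'a::ab_semigroup_add \<Rightarrow> 'b::ring"
  assumes "polynomial_map_le S (Some d) f"
  shows "polynomial_map_le S (Some d) (\<lambda>t. c * f t)"
  using assms
proof (induction d arbitrary: f)
  case 0
  then show ?case by auto
next
  case (Suc d)
  have "fwd_diff s (\<lambda>t. c * f t) = (\<lambda>t. c * fwd_diff s f t)" for s
    by (auto simp: fwd_diff_def fun_eq_iff algebra_simps)
  then show ?case
    using Suc by (auto simp: polynomial_map_le_Suc_iff simp del: polynomial_map_le.simps)
qed

text \<open>The discrete Leibniz rule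
  \<open>\<Delta>\<^sub>s (f * g) t = \<Delta>\<^sub>s f t * g (s + t) + f t * \<Delta>\<^sub>s g t\<close>
  writes a difference of a product as two products of smaller total degree bound; constant factors
  are the base of the induction.\<close>

lemma polynomial_map_le_mult:
  fixes f g :: "'a::ab_semigroup_add \<Rightarrow> 'b::comm_ring"
  assumes "polynomial_map_le S (Some a) f" "polynomial_map_le S (Some b) g"
    and closed: "\<And>s t. s \<in> S \<Longrightarrow> t \<in> S \<Longrightarrow> s + t \<in> S"
  shows "polynomial_map_le S (Some (a + b)) (\<lambda>t. f t * g t)"
  using assms(1,2)
proof (induction "a + b" arbitrary: a b f g rule: less_induct)
  case less
  have const: "polynomial_map_le S (Some e) (\<lambda>t. u t * v t)"
    if u: "polynomial_map_le S (Some 0) u" and v: "polynomial_map_le S (Some e) v"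
    for e and u v :: "'a \<Rightarrow> 'b"
  proof -
    obtain c where "\<forall>s\<in>S. u s = c" using u by auto
    then show ?thesis
      using polynomial_map_le_cong[OF polynomial_map_le_const_mult[OF v, of c] closed] by auto
  qed
  consider "a = 0" | "b = 0" | a' b' where "a = Suc a'" "b = Suc b'"
    by (cases a; cases b) auto
  then show ?case
  proof cases
    case 1
    then show ?thesis using const less.prems by simp
  next
    case 2
    then show ?thesis using const[of g a f] less.prems by (simp add: mult.commute)
  next
    case 3
    have "polynomial_map_le S (Some (a' + b)) (fwd_diff s (\<lambda>t. f t * g t))" if s: "s \<in> S" for s
    proof -
      have "polynomial_map_le S (Some a') (fwd_diff s f)" "polynomial_map_le S (Some b') (fwd_diff s g)"
        using less.prems s unfolding 3 polynomial_map_le_Suc_iff by blast+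
      then have "polynomial_map_le S (Some (a' + b)) (\<lambda>t. fwd_diff s f t * g (s + t))"
        "polynomial_map_le S (Some (a + b')) (\<lambda>t. f t * fwd_diff s g t)"
        using less.hyps[OF _ _ polynomial_map_le_shift[OF less.prems(2) closed s], of a' "fwd_diff s f"]
          less.hyps[OF _ less.prems(1), of b' "fwd_diff s g"] 3 by simp_all
      then have "polynomial_map_le S (Some (a' + b)) (\<lambda>t. fwd_diff s f t * g (s + t) + f t * fwd_diff s g t)"
        using 3 by (intro polynomial_map_le_add) simp_all
      also have "(\<lambda>t. fwd_diff s f t * g (s + t) + f t * fwd_diff s g t) = fwd_diff s (\<lambda>t. f t * g t)"
        by (auto simp: fwd_diff_def fun_eq_iff algebra_simps)
      finally show ?thesis .
    qed
    then show ?thesis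
      using 3 by (simp add: polynomial_map_le_Suc_iff del: polynomial_map_le.simps)
  qed
qed

lemma polynomial_map_le_power:
  fixes f :: "'a::ab_semigroup_add \<Rightarrow> 'b::comm_ring_1"
  assumes "polynomial_map_le S (Some a) f"
    and "\<And>s t. s \<in> S \<Longrightarrow> t \<in> S \<Longrightarrow> s + t \<in> S"
  shows "polynomial_map_le S (Some (n * a)) (\<lambda>t. f t ^ n)"
proof (induction n)
  case (Suc n)
  then show ?case using polynomial_map_le_mult[OF assms(1) _ assms(2)] by simp
qed (simp add: polynomial_map_le_const del: polynomial_map_le.simps)

lemma polynomial_map_le_prod:
  fixes f :: "'i \<Rightarrow> 'a::ab_semigroup_add \<Rightarrow> 'b::comm_ring_1"
  assumes "\<And>i. i \<in> I \<Longrightarrow> polynomial_map_le S (Some (a i)) (f i)"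
    and "\<And>s t. s \<in> S \<Longrightarrow> t \<in> S \<Longrightarrow> s + t \<in> S"
  shows "polynomial_map_le S (Some (sum a I)) (\<lambda>t. \<Prod>i\<in>I. f i t)"
  using assms(1)
proof (induction I rule: infinite_finite_induct)
  case (insert i I)
  then show ?case using polynomial_map_le_mult[OF _ _ assms(2), of "a i" "f i"] by simp
qed (simp_all add: polynomial_map_le_const del: polynomial_map_le.simps)

lemma polynomial_map_le_fwd_diff_funpow:
  fixes f :: "'a::ab_semigroup_add \<Rightarrow> 'b::ab_group_add"
  assumes "polynomial_map_le S (Some d) f" "s \<in> S" "k \<le> d"
  shows "polynomial_map_le S (Some (d - k)) ((fwd_diff s ^^ k) f)"
  using assms(3)
proof (induction k)
  case (Suc k)
  then have "polynomial_map_le S (Some (Suc (d - Suc k))) ((fwd_diff s ^^ k) f)"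
    by (simp add: Suc_diff_Suc del: polynomial_map_le.simps)
  then show ?case
    using assms(2) by (simp add: polynomial_map_le_Suc_iff del: polynomial_map_le.simps)
qed (use assms in simp)

text \<open>The same principle as in \<open>polynomial_map_le_affine_comp\<close>, for iterated differences with a fixed step.\<close>

lemma fwd_diff_funpow_affine_comp:
  assumes "\<And>t. \<psi> (s + t) = s' + \<psi> t"
  shows "(fwd_diff s ^^ k) (\<lambda>t. f (\<psi> t)) t = (fwd_diff s' ^^ k) f (\<psi> t)"
proof (induction k arbitrary: t)
  case (Suc k)
  then have "(fwd_diff s ^^ k) (\<lambda>t. f (\<psi> t)) = (\<lambda>t. (fwd_diff s' ^^ k) f (\<psi> t))" by blast
  then show ?case by (simp add: fwd_diff_funpow_Suc assms del: funpow.simps)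
qed simp

lemma continuous_on_fwd_diff_funpow:
  fixes f :: "'a::topological_monoid_add \<Rightarrow> 'b::topological_group_add"
  assumes "continuous_on S f" "s \<in> S" "\<And>t. t \<in> S \<Longrightarrow> s + t \<in> S"
  shows "continuous_on S ((fwd_diff s ^^ k) f)"
proof (induction k)
  case (Suc k)
  have "continuous_on S (\<lambda>t. (fwd_diff s ^^ k) f (s + t))"
    by (rule continuous_on_compose2[OF Suc]) (use assms in \<open>auto intro!: continuous_intros\<close>)
  then show ?case using Suc by (auto simp: fwd_diff_def[abs_def] intro!: continuous_intros)
qed (use assms in simp)

section \<open>Newton interpolation\<close>

text \<open>Newton's forward difference formula.  The formula at degree \<open>d\<close> for \<open>\<Delta>h\<close> gives the increments of
  \<open>h\<close>; summing them is Pascal's rule.\<close>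

lemma newton_interpolation_nat:
  fixes h :: "nat \<Rightarrow> 'a::comm_ring_1"
  assumes "polynomial_map_le UNIV (Some d) h"
  shows "h n = (\<Sum>k\<le>d. of_nat (n choose k) * (fwd_diff 1 ^^ k) h 0)"
  using assms
proof (induction d arbitrary: h n)
  case 0
  then show ?case by auto
next
  case (Suc d)
  have step: "h (Suc n) = h n + (\<Sum>k\<le>d. of_nat (n choose k) * (fwd_diff 1 ^^ Suc k) h 0)" for n
  proof -
    have "fwd_diff 1 h n = (\<Sum>k\<le>d. of_nat (n choose k) * (fwd_diff 1 ^^ k) (fwd_diff 1 h) 0)"
      using Suc by (auto simp: polynomial_map_le_Suc_iff simp del: polynomial_map_le.simps)
    moreover have "h (Suc n) = h n + fwd_diff 1 h n" by (simp add: fwd_diff_def)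
    ultimately show ?thesis by (simp add: funpow_Suc_right del: funpow.simps)
  qed
  show ?case
  proof (induction n)
    case 0
    show ?case by (simp add: sum.atMost_Suc_shift del: funpow.simps sum.atMost_Suc)
  next
    case (Suc n)
    then show ?case
      unfolding step
      by (simp add: sum.atMost_Suc_shift distrib_right sum.distrib del: funpow.simps sum.atMost_Suc)
  qed
qed

definition gbinomial_poly :: "nat \<Rightarrow> real poly" where
  "gbinomial_poly k = smult (1 / fact k) (\<Prod>i<k. [:- of_nat i, 1:])"

lemma poly_gbinomial_poly: "poly (gbinomial_poly k) u = u gchoose k"
  by (simp add: gbinomial_poly_def poly_prod gbinomial_prod_rev atLeast0LessThan)

lemma poly_eq_if_eq_on_nat:
  fixes p q :: "'a::{idom, ring_char_0} poly"
  assumes "\<And>n. poly p (of_nat n) = poly q (of_nat n)"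
  shows "p = q"
proof (rule ccontr)
  assume "p \<noteq> q"
  then have "finite {x. poly (p - q) x = 0}" by (intro poly_roots_finite) simp
  moreover have "range of_nat \<subseteq> {x. poly (p - q) x = 0}" using assms by auto
  ultimately have "finite (range (of_nat :: nat \<Rightarrow> 'a))" by (rule rev_finite_subset)
  then show False using finite_imageD[OF _ inj_of_nat] by auto
qed

text \<open>Continuity is what makes the formula pass from the rational to the real points: without it,
  discontinuous additive functions would be counterexamples for \<open>d = 1\<close>.\<close>

lemma newton_interpolation_real:
  fixes g :: "real \<Rightarrow> real"
  assumes cont: "continuous_on {0..} g" and g: "polynomial_map_le {0..} (Some d) g" and u: "u \<ge> 0"
  shows "g u = (\<Sum>k\<le>d. (u gchoose k) * (fwd_diff 1 ^^ k) g 0)"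
proof -
  define N where "N c = (\<Sum>k\<le>d. smult (c k) (gbinomial_poly k))" for c
  have poly_N: "poly (N c) x = (\<Sum>k\<le>d. (x gchoose k) * c k)" for c x
    by (simp add: N_def poly_sum poly_gbinomial_poly mult.commute)
  \<comment> \<open>\<open>P q\<close> interpolates \<open>g\<close> on the lattice of mesh \<open>1/q\<close>: Newton's formula is applied to
    \<open>n \<mapsto> g (n/q)\<close> and then rescaled.\<close>
  define P where "P q = pcompose (N (\<lambda>k. (fwd_diff 1 ^^ k) (\<lambda>n. g (real n / q)) 0)) [:0, q:]" for q :: real
  have P: "g (real n / q) = poly (P q) (real n / q)" if "q > 0" for n q
  proof -
    have "polynomial_map_le (UNIV :: nat set) (Some d) (\<lambda>n. g (real n / q))"
      by (rule polynomial_map_le_affine_comp[OF g, where \<phi> = "\<lambda>n. real n / q" and \<psi> = "\<lambda>n. real n / q"])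
        (use that in \<open>auto simp: add_divide_distrib\<close>)
    from newton_interpolation_nat[OF this, of n] show ?thesis
      using that by (simp add: P_def poly_pcompose poly_N binomial_gbinomial)
  qed
  \<comment> \<open>Every natural number \<open>n = nq/q\<close> lies on the lattice of mesh \<open>1/q\<close>.\<close>
  have P_eq: "P (real q) = P 1" if "q > 0" for q
  proof (rule poly_eq_if_eq_on_nat)
    fix n
    show "poly (P (real q)) (of_nat n) = poly (P 1) (of_nat n)"
      using P[of "real q" "n * q"] P[of 1 n] that by simp
  qed
  \<comment> \<open>Rational approximation of \<open>u\<close> from below, at distance at most \<open>1/(q+1)\<close>.\<close>
  define x where "x q = real (nat \<lfloor>u * real (Suc q)\<rfloor>) / real (Suc q)" for q
  have gx: "g (x q) = poly (P 1) (x q)" for q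
    unfolding x_def using P[of "real (Suc q)"] P_eq[of "Suc q"] by simp
  have bounds: "u - 1 / real (Suc q) \<le> x q" "x q \<le> u" "0 \<le> x q" for q
  proof -
    have "u * real (Suc q) \<ge> 0" using u by simp
    then have "real (nat \<lfloor>u * real (Suc q)\<rfloor>) \<le> u * real (Suc q)"
      "u * real (Suc q) - 1 \<le> real (nat \<lfloor>u * real (Suc q)\<rfloor>)" by linarith+
    moreover have "u - 1 / real (Suc q) = (u * real (Suc q) - 1) / real (Suc q)"
      by (simp add: diff_divide_distrib del: of_nat_Suc)
    ultimately show "u - 1 / real (Suc q) \<le> x q" "x q \<le> u" "0 \<le> x q"
      by (simp_all add: x_def divide_right_mono pos_divide_le_eq del: of_nat_Suc)
  qed
  have "(\<lambda>q. u - 1 / real (Suc q)) \<longlonglongrightarrow> u - 0"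
    using LIMSEQ_inverse_real_of_nat by (intro tendsto_intros) (simp add: inverse_eq_divide)
  then have lim: "x \<longlonglongrightarrow> u"
    by (intro tendsto_sandwich[OF _ _ _ tendsto_const[of u], of "\<lambda>q. u - 1 / real (Suc q)" x])
      (simp_all add: bounds del: of_nat_Suc)
  have "(\<lambda>q. g (x q)) \<longlonglongrightarrow> g u"
    by (rule continuous_on_tendsto_compose[OF cont lim]) (use u bounds in auto)
  moreover have "(\<lambda>q. g (x q)) \<longlonglongrightarrow> poly (P 1) u"
    unfolding gx by (intro tendsto_intros lim)
  ultimately have "g u = poly (P 1) u" by (rule LIMSEQ_unique)
  also have "\<dots> = (\<Sum>k\<le>d. (u gchoose k) * (fwd_diff 1 ^^ k) g 0)"
    using fwd_diff_funpow_affine_comp[of real 1 1 _ g 0]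
    by (simp add: P_def poly_pcompose poly_N)
  finally show ?thesis .
qed

section \<open>Functions given by multivariate polynomials\<close>

text \<open>The degree bound belongs to the representing polynomial and not to the function: whether the
  degree is determined by the function never has to be decided.  The
  representation is required on the whole space, so that no domain has to be carried along.\<close>

definition is_mpoly_fun_le :: "nat \<Rightarrow> (real ^ 'n \<Rightarrow> real) \<Rightarrow> bool" where
  "is_mpoly_fun_le d h \<longleftrightarrow> (\<exists>p :: 'n mpolynomial. mpoly_degree p \<le> Some d \<and> h = mpoly_eval p)"

lemma mpoly_degree_le_Some_iff:
  "mpoly_degree p \<le> Some d \<longleftrightarrow>
    (\<forall>m\<in>Poly_Mapping.keys p. (\<Sum>i\<in>UNIV. Poly_Mapping.lookup m i) \<le> d)"
  by (auto simp: mpoly_degree_def)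

lemma is_mpoly_fun_le_monomial:
  assumes "(\<Sum>i\<in>UNIV. Poly_Mapping.lookup m i) \<le> d"
  shows "is_mpoly_fun_le d (\<lambda>x. c * (\<Prod>i\<in>UNIV. (x $ i) ^ Poly_Mapping.lookup m i))"
  unfolding is_mpoly_fun_le_def
proof (intro exI conjI)
  show "mpoly_degree (Poly_Mapping.single m c) \<le> Some d"
    using assms by (simp add: mpoly_degree_le_Some_iff)
qed (simp add: mpoly_eval_def fun_eq_iff)

lemma is_mpoly_fun_le_const: "is_mpoly_fun_le d (\<lambda>_. c)"
  using is_mpoly_fun_le_monomial[of 0 d c] by simp

lemma is_mpoly_fun_le_coordinate: "is_mpoly_fun_le 1 (\<lambda>x. x $ i)"
proof -
  have "(\<Prod>j\<in>UNIV. (x $ j) ^ Poly_Mapping.lookup (Poly_Mapping.single i 1) j) = x $ i" for x :: "real ^ 'a"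
  proof -
    have "(x $ j) ^ Poly_Mapping.lookup (Poly_Mapping.single i 1) j = (if j = i then x $ i else 1)" for j
      by (simp add: lookup_single)
    then show ?thesis by simp
  qed
  moreover have "(\<Sum>j\<in>UNIV. Poly_Mapping.lookup (Poly_Mapping.single i (1::nat)) j) \<le> 1"
    by (simp add: lookup_single when_def)
  ultimately show ?thesis using is_mpoly_fun_le_monomial[of "Poly_Mapping.single i 1" 1 1] by simp
qed

lemma is_mpoly_fun_le_add:
  assumes "is_mpoly_fun_le d f" "is_mpoly_fun_le d g"
  shows "is_mpoly_fun_le d (\<lambda>x. f x + g x)"
proof -
  obtain p q where pq: "mpoly_degree p \<le> Some d" "f = mpoly_eval p" "mpoly_degree q \<le> Some d" "g = mpoly_eval q"
    using assms unfolding is_mpoly_fun_le_def by blast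
  have "mpoly_eval (p + q) x = mpoly_eval p x + mpoly_eval q x" for x
    unfolding mpoly_eval_def by (rule setsum_keys_plus_distrib) (auto simp: algebra_simps)
  moreover have "mpoly_degree (p + q) \<le> Some d"
    using pq keys_add[of p q] unfolding mpoly_degree_le_Some_iff by blast
  ultimately show ?thesis
    unfolding is_mpoly_fun_le_def pq by (intro exI[of _ "p + q"]) auto
qed

lemma is_mpoly_fun_le_sum:
  assumes "\<And>i. i \<in> I \<Longrightarrow> is_mpoly_fun_le d (f i)"
  shows "is_mpoly_fun_le d (\<lambda>x. \<Sum>i\<in>I. f i x)"
  using assms
  by (induction I rule: infinite_finite_induct) (simp_all add: is_mpoly_fun_le_const is_mpoly_fun_le_add)

text \<open>Expanding the product into monomials leaves only additivity of the evaluation to be used; the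
  product of the representing polynomials does not have to be formed.\<close>

lemma is_mpoly_fun_le_mult:
  assumes "is_mpoly_fun_le a f" "is_mpoly_fun_le b g"
  shows "is_mpoly_fun_le (a + b) (\<lambda>x. f x * g x)"
proof -
  obtain p q where pq: "mpoly_degree p \<le> Some a" "f = mpoly_eval p" "mpoly_degree q \<le> Some b" "g = mpoly_eval q"
    using assms unfolding is_mpoly_fun_le_def by blast
  have "f x * g x = (\<Sum>m\<in>Poly_Mapping.keys p. \<Sum>l\<in>Poly_Mapping.keys q.
      Poly_Mapping.lookup p m * Poly_Mapping.lookup q l * (\<Prod>i\<in>UNIV. (x $ i) ^ Poly_Mapping.lookup (m + l) i))" for x
    unfolding pq mpoly_eval_def sum_product
    by (simp add: lookup_add power_add prod.distrib algebra_simps)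
  moreover have "is_mpoly_fun_le (a + b) (\<lambda>x. Poly_Mapping.lookup p m * Poly_Mapping.lookup q l *
      (\<Prod>i\<in>UNIV. (x $ i) ^ Poly_Mapping.lookup (m + l) i))"
    if "m \<in> Poly_Mapping.keys p" "l \<in> Poly_Mapping.keys q" for m l
    using pq that by (intro is_mpoly_fun_le_monomial)
      (auto simp: mpoly_degree_le_Some_iff lookup_add sum.distrib intro!: add_mono)
  ultimately show ?thesis by (simp add: is_mpoly_fun_le_sum)
qed

lemma is_mpoly_fun_le_gbinomial: "is_mpoly_fun_le k (\<lambda>x. x $ i gchoose k)"
proof -
  have "is_mpoly_fun_le k (\<lambda>x. \<Prod>j<k. x $ i - of_nat j)"
  proof (induction k)
    case (Suc k)
    have "is_mpoly_fun_le 1 (\<lambda>x. x $ i + - real k)"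
      by (intro is_mpoly_fun_le_add is_mpoly_fun_le_coordinate is_mpoly_fun_le_const)
    from is_mpoly_fun_le_mult[OF Suc this] show ?case by simp
  qed (simp add: is_mpoly_fun_le_const)
  from is_mpoly_fun_le_mult[OF is_mpoly_fun_le_const[of 0 "1 / fact k"] this] show ?thesis
    by (simp add: gbinomial_prod_rev atLeast0LessThan)
qed

text \<open>This is the reverse bound between the two degrees: a coordinate is additive, hence of degree at
  most 1, and products add degrees.\<close>

lemma polynomial_map_le_mpoly_eval:
  "polynomial_map_le nonneg_orthant (mpoly_degree p) (mpoly_eval p)"
proof (cases "p = 0")
  case True
  then show ?thesis by (simp add: mpoly_degree_def mpoly_eval_def)
next
  case False
  then obtain e where e: "mpoly_degree p = Some e" by (simp add: mpoly_degree_def)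
  have "polynomial_map_le nonneg_orthant (Some 1) (\<lambda>x::real^'a. x $ i)" for i
    by auto
  from polynomial_map_le_power[OF this add_in_nonneg_orthant]
  have power: "polynomial_map_le nonneg_orthant (Some n) (\<lambda>x::real^'a. (x $ i) ^ n)" for i n
    by (simp del: polynomial_map_le.simps)
  have "polynomial_map_le nonneg_orthant (Some e)
      (\<lambda>x. \<Prod>i\<in>UNIV. (x $ i) ^ Poly_Mapping.lookup m i)" if "m \<in> Poly_Mapping.keys p" for m
    by (rule polynomial_map_le_mono[OF polynomial_map_le_prod[OF power add_in_nonneg_orthant] _
          add_in_nonneg_orthant])
      (use mpoly_degree_le_Some_iff[of p e] e that in auto)
  then show ?thesis
    unfolding e mpoly_eval_def by (intro polynomial_map_le_sum polynomial_map_le_const_mult)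
qed

section \<open>Polynomiality by induction on the coordinates\<close>

definition coord_proj :: "'n set \<Rightarrow> real ^ 'n \<Rightarrow> real ^ 'n" where
  "coord_proj A x = (\<chi> j. if j \<in> A then x $ j else 0)"

text \<open>Induction on the set of coordinates on which \<open>f\<close> depends, for all \<open>d\<close> and \<open>f\<close> at once, since the
  coefficients \<open>F k\<close> of the Newton expansion in one coordinate are new maps with smaller degree
  bounds \<open>d - k\<close>.\<close>

lemma mpoly_fun_if_depends_on:
  fixes f :: "real ^ 'n \<Rightarrow> real"
  assumes "finite A" and "continuous_on nonneg_orthant f"
    and "polynomial_map_le nonneg_orthant (Some d) f"
    and "\<And>x. x \<in> nonneg_orthant \<Longrightarrow> f x = f (coord_proj A x)"
  shows "\<exists>h. is_mpoly_fun_le d h \<and> (\<forall>x\<in>nonneg_orthant. f x = h x)"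
  using assms
proof (induction A arbitrary: d f rule: finite_induct)
  case empty
  have "coord_proj {} x = 0" for x :: "real ^ 'n" by (simp add: coord_proj_def vec_eq_iff)
  with empty have "\<forall>x\<in>nonneg_orthant. f x = f 0" by metis
  then show ?case using is_mpoly_fun_le_const by blast
next
  case (insert i A)
  let ?e = "axis i 1 :: real ^ 'n"
  define F where "F k x = (fwd_diff ?e ^^ k) f (coord_proj A x)" for k x
  have e: "?e \<in> nonneg_orthant" by (simp add: nonneg_orthant_def axis_def)
  have proj: "coord_proj A x \<in> nonneg_orthant" if "x \<in> nonneg_orthant" for x
    using that by (simp add: coord_proj_def nonneg_orthant_def)
  have line: "u *\<^sub>R ?e + y \<in> nonneg_orthant" if "u \<ge> 0" "y \<in> nonneg_orthant" for u y
    using that by (simp add: nonneg_orthant_def axis_def)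
  \<comment> \<open>Newton's formula along the half-line in direction \<open>?e\<close> issuing from \<open>coord_proj A x\<close>; the point
    \<open>x\<close> may be replaced by the point of that half-line with parameter \<open>x $ i\<close>.\<close>
  have newton: "f x = (\<Sum>k\<le>d. (x $ i gchoose k) * F k x)" if x: "x \<in> nonneg_orthant" for x
  proof -
    let ?\<psi> = "\<lambda>u. u *\<^sub>R ?e + coord_proj A x"
    have "x $ i \<ge> 0" using x by (simp add: nonneg_orthant_def)
    moreover have "continuous_on {0..} (\<lambda>u. f (?\<psi> u))"
      by (rule continuous_on_compose2[OF insert.prems(1)])
        (use line proj[OF x] in \<open>auto intro!: continuous_intros\<close>)
    moreover have "polynomial_map_le {0..} (Some d) (\<lambda>u. f (?\<psi> u))"
      by (rule polynomial_map_le_affine_comp[OF insert.prems(2), where \<phi> = "\<lambda>u. u *\<^sub>R ?e" and \<psi> = ?\<psi>])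
        (use line[OF _ zero_in_nonneg_orthant] line[OF _ proj[OF x]] in \<open>auto simp: scaleR_left_distrib\<close>)
    ultimately have "f (?\<psi> (x $ i)) = (\<Sum>k\<le>d. (x $ i gchoose k) * (fwd_diff 1 ^^ k) (\<lambda>u. f (?\<psi> u)) 0)"
      by (intro newton_interpolation_real)
    moreover have "(fwd_diff 1 ^^ k) (\<lambda>u. f (?\<psi> u)) 0 = F k x" for k
      using fwd_diff_funpow_affine_comp[of ?\<psi> 1 ?e k f 0] by (simp add: F_def scaleR_left_distrib)
    moreover have "?\<psi> (x $ i) = coord_proj (insert i A) x"
      using insert.hyps by (auto simp: coord_proj_def axis_def vec_eq_iff)
    ultimately show ?thesis using insert.prems(3)[OF x] by simp
  qed
  have "\<exists>h. is_mpoly_fun_le (d - k) h \<and> (\<forall>x\<in>nonneg_orthant. F k x = h x)" if "k \<le> d" for k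
  proof (rule insert.IH)
    have "continuous_on nonneg_orthant ((fwd_diff ?e ^^ k) f)"
      using insert.prems(1) e add_in_nonneg_orthant by (intro continuous_on_fwd_diff_funpow) auto
    then show "continuous_on nonneg_orthant (F k)"
      unfolding F_def
    proof (rule continuous_on_compose2)
      have "continuous_on nonneg_orthant (\<lambda>x. if j \<in> A then x $ j else 0)" for j
        by (cases "j \<in> A") (auto intro!: continuous_intros)
      then show "continuous_on nonneg_orthant (coord_proj A)"
        unfolding coord_proj_def by (intro continuous_on_vec_lambda)
    qed (use proj in auto)
    show "polynomial_map_le nonneg_orthant (Some (d - k)) (F k)"
      by (rule polynomial_map_le_affine_comp[OF polynomial_map_le_fwd_diff_funpow[OF insert.prems(2) e that],
            where \<phi> = "coord_proj A" and \<psi> = "coord_proj A"])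
        (use proj add_in_nonneg_orthant in \<open>auto simp: F_def coord_proj_def vec_eq_iff\<close>)
    have "coord_proj A (coord_proj A x) = coord_proj A x" for x :: "real ^ 'n"
      by (simp add: coord_proj_def vec_eq_iff)
    then show "F k x = F k (coord_proj A x)" for x by (simp add: F_def)
  qed
  then obtain h where h: "\<And>k. k \<le> d \<Longrightarrow> is_mpoly_fun_le (d - k) (h k)"
    "\<And>k x. k \<le> d \<Longrightarrow> x \<in> nonneg_orthant \<Longrightarrow> F k x = h k x" by metis
  have "is_mpoly_fun_le d (\<lambda>x. \<Sum>k\<le>d. (x $ i gchoose k) * h k x)"
  proof (rule is_mpoly_fun_le_sum)
    fix k assume "k \<in> {..d}"
    with is_mpoly_fun_le_mult[OF is_mpoly_fun_le_gbinomial[of k i] h(1)[of k]]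
    show "is_mpoly_fun_le d (\<lambda>x. (x $ i gchoose k) * h k x)" by auto
  qed
  moreover have "f x = (\<Sum>k\<le>d. (x $ i gchoose k) * h k x)" if "x \<in> nonneg_orthant" for x
    unfolding newton[OF that] by (intro sum.cong) (use h that in auto)
  ultimately show ?case by blast
qed

theorem theorem4:
  fixes f :: "real ^ 'n \<Rightarrow> real" and d :: "nat option"
  assumes "continuous_on nonneg_orthant f"
    and "polynomial_map nonneg_orthant f"
    and "polynomial_map_degree nonneg_orthant f = d"
  shows "\<exists>p :: 'n mpolynomial. mpoly_degree p = d \<and>
           (\<forall>x\<in>nonneg_orthant. f x = mpoly_eval p x)"
proof -
  have d: "d = (LEAST e. polynomial_map_le nonneg_orthant e f)"
    using assms(3) by (simp only: polynomial_map_degree_def)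
  obtain e where "polynomial_map_le nonneg_orthant e f"
    using assms(2) unfolding polynomial_map_def ..
  then have f: "polynomial_map_le nonneg_orthant d f"
    unfolding d by (rule LeastI)
  obtain p :: "'n mpolynomial" where
    p: "mpoly_degree p \<le> d" "\<forall>x\<in>nonneg_orthant. f x = mpoly_eval p x"
  proof (cases d)
    case None
    show thesis by (rule that[of 0]) (use f None in \<open>auto simp: mpoly_degree_def mpoly_eval_def\<close>)
  next
    case (Some n)
    have "coord_proj UNIV x = x" for x :: "real ^ 'n" by (simp add: coord_proj_def)
    then have "\<exists>h. is_mpoly_fun_le n h \<and> (\<forall>x\<in>nonneg_orthant. f x = h x)"
      using f[unfolded Some] by (intro mpoly_fun_if_depends_on[OF finite[of UNIV] assms(1)]) simp_all
    then obtain p :: "'n mpolynomial" where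
      "mpoly_degree p \<le> Some n" "\<forall>x\<in>nonneg_orthant. f x = mpoly_eval p x"
      unfolding is_mpoly_fun_le_def by blast
    then show thesis using that[of p] Some by simp
  qed
  have "polynomial_map_le nonneg_orthant (mpoly_degree p) f"
    by (rule polynomial_map_le_cong[OF polynomial_map_le_mpoly_eval add_in_nonneg_orthant])
      (use p(2) in auto)
  \<comment> \<open>minimality of \<open>d\<close> among the degree bounds of \<open>f\<close>\<close>
  then have "d \<le> mpoly_degree p"
    unfolding d by (rule Least_le)
  with p(1) have "mpoly_degree p = d" by (rule antisym)
  with p(2) show ?thesis by blast
qed

end
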